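(* Let $\Omega=[a,b]\subset\mathbb{R}$ be a bounded interval and let $\mathcal{X}_{n+1}=\{x_i\}_{i=0,\dots,n}\subset\Omega$, $n\in\mathbb{N}$, be a set of distinct nodes, sorted in increasing order. Let $\xi$ be an interior point of $\Omega$ such that the two subsets $$\mathcal{X}^1=\{x_i\in\mathcal{X}_{n+1} : x_i\le\xi\},\qquad \mathcal{X}^2=\{x_i\in\mathcal{X}_{n+1} : x_i>\xi\}$$ satisfy one of the following properties: (1) $|\mathcal{X}^1|=|\mathcal{X}^2|$ (the odd case); (2) $|\mathcal{X}^1|=|\mathcal{X}^2|+1$ (the even case). Let $\Omega^1=[a,\xi]$, $\Omega^2=\,]\xi,b]$ and, for $\kappa\in\mathbb{R}$, $\kappa>0$, let $S_\kappa:\Omega\to\mathbb{R}$ be defined by $S_\kappa(x)=x$ if $x\in\Omega^1$ and $S_\kappa(x)=x+\kappa$ if $x\in\Omega^2$. Let $\Lambda^\kappa(\mathcal{X}_{n+1},\Omega)$ be the Lebesgue constant related to the mapped Lagrange basis $\{\ell_0^\kappa,\dots,\ell_n^\kappa\}$, where $$\ell_i^\kappa(x)=\prod_{\substack{j=0\\ j\ne i}}^n\frac{S_\kappa(x)-S_\kappa(x_j)}{S_\kappa(x_i)-S_\kappa(x_j)},\qquad i=0,\dots,n,\ x\in\Omega.$$ Then $$\lim_{\kappa\to\infty}\Lambda^\kappa(\mathcal{X}_{n+1},\Omega)=\begin{cases}\max\{\Lambda(\mathcal{X}^1,\Omega^1),\Lambda(\mathcal{X}^2,\Omega^2)\} &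 \text{in the odd case},\\ \max\{\Lambda(\mathcal{X}^1,\Omega^1),R(\mathcal{X}^2,\Omega^2)\} & \text{in the even case},\end{cases}$$ where $$R(\mathcal{X}^2,\Omega^2)=\sup_{x\in\Omega^2}\Big(\sum_{i=0}^{n/2}|r_i(x)|+\lambda(\mathcal{X}^2;x)\Big),\qquad r_i(x)=\prod_{j=n/2+1}^n(x-x_j)\prod_{\substack{j=0\\ j\ne i}}^{n/2}\frac{1}{x_i-x_j},$$ and $\Lambda$, $\lambda$ are the classical Lebesgue constant and Lebesgue function.
   Context: For a finite set of distinct nodes $\mathcal{Y}\subset\mathbb{R}$, the classical Lebesgue function is $\lambda(\mathcal{Y};x)=\sum_{y\in\mathcal{Y}}\prod_{z\in\mathcal{Y},\,z\ne y}\left|\frac{x-z}{y-z}\right|$, and the classical Lebesgue constant on a bounded interval $J$ (possibly half-open) is $\Lambda(\mathcal{Y},J)=\sup_{x\in J}\lambda(\mathcal{Y};x)$. The Lebesgue constant related to the mapped basis is $\Lambda^\kappa(\mathcal{X}_{n+1},\Omega)=\sup_{x\in\Omega}\sum_{i=0}^n|\ell_i^\kappa(x)|$. *)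

theory Defs
  imports Complex_Main
begin

text \<open>All suprema below are real-valued. They are only used for nonempty bounded intervals,
  on which the functions involved are sums of absolute values of (piecewise) polynomials and
  therefore bounded.\<close>

definition lebesgue_function :: "real set \<Rightarrow> real \<Rightarrow> real" where
  "lebesgue_function Y t = (\<Sum>y\<in>Y. \<Prod>z\<in>Y - {y}. \<bar>(t - z) / (y - z)\<bar>)"

definition lebesgue_constant :: "real set \<Rightarrow> real set \<Rightarrow> real" where
  "lebesgue_constant Y J = (SUP t\<in>J. lebesgue_function Y t)"

definition gap_map :: "real \<Rightarrow> real \<Rightarrow> real \<Rightarrow> real" where
  "gap_map \<xi> \<kappa> t = (if t \<le> \<xi> then t else t + \<kappa>)"

definition mapped_lagrange :: "(real \<Rightarrow> real) \<Rightarrow> nat \<Rightarrow> (nat \<Rightarrow> real) \<Rightarrow> nat \<Rightarrow> real \<Rightarrow> real" where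
  "mapped_lagrange S n x i t = (\<Prod>j\<in>{0..n} - {i}. (S t - S (x j)) / (S (x i) - S (x j)))"

definition mapped_lebesgue_constant ::
    "(real \<Rightarrow> real) \<Rightarrow> nat \<Rightarrow> (nat \<Rightarrow> real) \<Rightarrow> real set \<Rightarrow> real" where
  "mapped_lebesgue_constant S n x J = (SUP t\<in>J. \<Sum>i=0..n. \<bar>mapped_lagrange S n x i t\<bar>)"

text \<open>The next two definitions are meant for even \<open>n\<close>, where \<open>n div 2\<close> is exact.\<close>

definition gap_residual :: "nat \<Rightarrow> (nat \<Rightarrow> real) \<Rightarrow> nat \<Rightarrow> real \<Rightarrow> real" where
  "gap_residual n x i t =
    (\<Prod>j=n div 2 + 1..n. t - x j) * (\<Prod>j\<in>{0..n div 2} - {i}. 1 / (x i - x j))"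

definition gap_residual_constant :: "nat \<Rightarrow> (nat \<Rightarrow> real) \<Rightarrow> real set \<Rightarrow> real set \<Rightarrow> real" where
  "gap_residual_constant n x Y J =
    (SUP t\<in>J. (\<Sum>i=0..n div 2. \<bar>gap_residual n x i t\<bar>) + lebesgue_function Y t)"

end

theory Submission
  imports Defs "HOL-Analysis.Uniform_Limit"
begin

text \<open>
  For a point \<open>t\<close> of one side of \<open>\<xi>\<close>, let \<open>A\<close> be the nodes on the side of \<open>t\<close> and \<open>B\<close> those on
  the other side. A difference \<open>S\<^sub>\<kappa>(u) - S\<^sub>\<kappa>(v)\<close> equals \<open>u - v\<close> if \<open>u\<close> and \<open>v\<close> lie on the same
  side, and it is \<open>\<plusminus>\<kappa>\<close> up to a bounded error otherwise, so its modulus divided by \<open>\<kappa>\<close> tends to \<open>1\<close>,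
  uniformly on bounded sets. Pulling one \<open>\<kappa>\<close> out of each factor that crosses the gap gives the
  behaviour of the basis function \<open>\<ell>\<^sub>y\<close> of a node \<open>y\<close>:

  \<^item> If \<open>y \<in> A\<close>, the crossing factors of numerator and denominator both range over \<open>B\<close>, the powers
    of \<open>\<kappa>\<close> cancel, and \<open>\<bar>\<ell>\<^sub>y(t)\<bar>\<close> tends to the classical basis function of \<open>A\<close>
    (\<open>same_side_basis_limit\<close>).
  \<^item> If \<open>y \<in> B\<close>, the numerator crosses at \<open>B - {y}\<close> and the denominator at \<open>A\<close>, which leaves the
    power \<open>\<kappa> ^ (\<bar>B\<bar> - 1 - \<bar>A\<bar>)\<close> (\<open>opposite_side_basis_limit\<close>). The balance of the two sides makes
    the exponent nonpositive. It is zero only if \<open>\<bar>B\<bar> = \<bar>A\<bar> + 1\<close>, that is, for \<open>t\<close> to the right of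
    \<open>\<xi>\<close> in the even case, and then what survives is the residual \<open>\<bar>r\<^sub>i(t)\<bar>\<close>.

  Since the convergence is uniform on each side, it is uniform on all of \<open>\<Omega>\<close>; the supremum is
  continuous under uniform convergence (\<open>tendsto_SUP_uniform_limit\<close>), and the supremum of the limit
  over \<open>\<Omega> = \<Omega>\<^sup>1 \<union> \<Omega>\<^sup>2\<close> is the maximum of the suprema over the two parts.
\<close>

section \<open>Uniform limits of products, sums and suprema\<close>

text \<open>Multiplication preserves uniform limits only for bounded limit functions, so boundedness of the
  limit product has to be carried through the induction.\<close>

lemma uniform_limit_prod_bounded:
  fixes f :: "'i \<Rightarrow> 'a \<Rightarrow> 'b \<Rightarrow> real"
  assumes "finite I"
    and "\<And>i. i \<in> I \<Longrightarrow> uniform_limit T (f i) (l i) F"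
    and "\<And>i. i \<in> I \<Longrightarrow> bounded (l i ` T)"
  shows "uniform_limit T (\<lambda>k t. \<Prod>i\<in>I. f i k t) (\<lambda>t. \<Prod>i\<in>I. l i t) F
         \<and> bounded ((\<lambda>t. \<Prod>i\<in>I. l i t) ` T)"
  using assms
proof (induction I)
  case empty
  then show ?case by (auto intro!: uniform_limit_const simp: image_constant_conv)
next
  case (insert j I)
  then have *: "uniform_limit T (\<lambda>k t. \<Prod>i\<in>I. f i k t) (\<lambda>t. \<Prod>i\<in>I. l i t) F"
    "bounded ((\<lambda>t. \<Prod>i\<in>I. l i t) ` T)" by auto
  have "bounded ((\<lambda>t. l j t * (\<Prod>i\<in>I. l i t)) ` T)"
  proof -
    obtain c d where "\<And>t. t \<in> T \<Longrightarrow> \<bar>l j t\<bar> \<le> c" "\<And>t. t \<in> T \<Longrightarrow> \<bar>\<Prod>i\<in>I. l i t\<bar> \<le> d"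
      using *(2) insert.prems(2)[of j] unfolding bounded_iff by (auto simp del: abs_prod)
    then have "\<bar>l j t * (\<Prod>i\<in>I. l i t)\<bar> \<le> c * d" if "t \<in> T" for t
      unfolding abs_mult using that by (intro mult_mono) (auto intro: order_trans[OF abs_ge_zero])
    then show ?thesis unfolding bounded_iff by (auto simp del: abs_prod abs_mult)
  qed
  moreover have "uniform_limit T (\<lambda>k t. f j k t * (\<Prod>i\<in>I. f i k t)) (\<lambda>t. l j t * (\<Prod>i\<in>I. l i t)) F"
    using insert.prems * by (intro uniform_lim_mult) auto
  ultimately show ?case using insert.hyps by simp
qed

lemma uniform_limit_sum:
  fixes f :: "'i \<Rightarrow> 'a \<Rightarrow> 'b \<Rightarrow> real"
  assumes "finite I" "\<And>i. i \<in> I \<Longrightarrow> uniform_limit T (f i) (l i) F"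
  shows "uniform_limit T (\<lambda>k t. \<Sum>i\<in>I. f i k t) (\<lambda>t. \<Sum>i\<in>I. l i t) F"
  using assms by (induction I) (auto intro!: uniform_limit_const uniform_limit_add)

text \<open>Functions that are uniformly \<open>e\<close>-close have suprema that are \<open>e\<close>-close. Boundedness of the
  limit also bounds the approximating functions eventually, so that their real-valued suprema are
  genuine ones.\<close>

lemma tendsto_SUP_uniform_limit:
  fixes f :: "'a \<Rightarrow> 'b \<Rightarrow> real"
  assumes lim: "uniform_limit T f g F" and bnd: "bounded (g ` T)" and ne: "T \<noteq> {}"
  shows "((\<lambda>k. SUP t\<in>T. f k t) \<longlongrightarrow> (SUP t\<in>T. g t)) F"
proof (rule tendstoI)
  fix e :: real
  assume "e > 0"
  then have "\<forall>\<^sub>F k in F. \<forall>t\<in>T. dist (f k t) (g t) < e / 2"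
    using lim by (intro uniform_limitD) auto
  then show "\<forall>\<^sub>F k in F. dist (SUP t\<in>T. f k t) (SUP t\<in>T. g t) < e"
  proof eventually_elim
    case (elim k)
    then have close: "f k t \<le> g t + e / 2" "g t \<le> f k t + e / 2" if "t \<in> T" for t
      using bspec[OF elim that] unfolding dist_real_def by linarith+
    have g: "bdd_above (g ` T)" by (simp add: bnd bounded_imp_bdd_above)
    have f_le: "f k t \<le> (SUP t\<in>T. g t) + e / 2" if "t \<in> T" for t
      using close(1)[OF that] cSUP_upper[OF that g] by linarith
    then have f: "bdd_above (f k ` T)" by (auto intro!: bdd_aboveI)
    have "(SUP t\<in>T. f k t) \<le> (SUP t\<in>T. g t) + e / 2"
      using f_le ne by (intro cSUP_least) auto
    moreover have "(SUP t\<in>T. g t) \<le> (SUP t\<in>T. f k t) + e / 2"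
    proof (rule cSUP_least[OF ne])
      show "g t \<le> (SUP t\<in>T. f k t) + e / 2" if "t \<in> T" for t
        using close(2)[OF that] cSUP_upper[OF that f] by linarith
    qed
    ultimately show ?case using \<open>e > 0\<close> by (simp add: dist_real_def abs_if)
  qed
qed

section \<open>Differences that cross the gap\<close>

text \<open>The difference is \<open>\<plusminus>\<kappa> + (t - z)\<close>, so its modulus differs from \<open>\<kappa>\<close> by at most \<open>\<bar>t\<bar> + \<bar>z\<bar>\<close>.\<close>

lemma uniform_limit_gap_over_width:
  fixes T :: "real set"
  assumes "bounded T" and opp: "\<And>t. t \<in> T \<Longrightarrow> (t \<le> \<xi>) \<noteq> (z \<le> \<xi>)"
  shows "uniform_limit T (\<lambda>\<kappa> t. \<bar>gap_map \<xi> \<kappa> t - gap_map \<xi> \<kappa> z\<bar> / \<kappa>) (\<lambda>_. 1) at_top"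
proof (rule uniform_limitI)
  fix e :: real
  assume e: "e > 0"
  obtain C where C: "\<And>t. t \<in> T \<Longrightarrow> \<bar>t\<bar> \<le> C"
    using \<open>bounded T\<close> unfolding bounded_iff by auto
  show "\<forall>\<^sub>F \<kappa> in at_top. \<forall>t\<in>T.
          dist (\<bar>gap_map \<xi> \<kappa> t - gap_map \<xi> \<kappa> z\<bar> / \<kappa>) 1 < e"
    using eventually_gt_at_top[of 0] eventually_gt_at_top[of "(C + \<bar>z\<bar>) / e"]
  proof eventually_elim
    case (elim \<kappa>)
    show ?case
    proof
      fix t assume t: "t \<in> T"
      have "\<bar>\<bar>gap_map \<xi> \<kappa> t - gap_map \<xi> \<kappa> z\<bar> - \<kappa>\<bar> \<le> C + \<bar>z\<bar>"
        using C[OF t] opp[OF t] elim(1) unfolding gap_map_def by (auto split: if_splits)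
      also have "\<dots> < e * \<kappa>" using elim(2) e by (simp add: field_simps)
      finally have "\<bar>\<bar>gap_map \<xi> \<kappa> t - gap_map \<xi> \<kappa> z\<bar> - \<kappa>\<bar> / \<kappa> < e"
        using elim(1) by (simp add: field_simps)
      moreover have "\<bar>gap_map \<xi> \<kappa> t - gap_map \<xi> \<kappa> z\<bar> / \<kappa> - 1
          = (\<bar>gap_map \<xi> \<kappa> t - gap_map \<xi> \<kappa> z\<bar> - \<kappa>) / \<kappa>"
        using elim(1) by (simp add: field_simps)
      ultimately show "dist (\<bar>gap_map \<xi> \<kappa> t - gap_map \<xi> \<kappa> z\<bar> / \<kappa>) 1 < e"
        using elim(1) by (simp add: dist_real_def)
    qed
  qed
qed

lemma uniform_limit_prod_gap_over_width:
  fixes T :: "real set"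
  assumes "bounded T" "finite B" "\<And>t z. t \<in> T \<Longrightarrow> z \<in> B \<Longrightarrow> (t \<le> \<xi>) \<noteq> (z \<le> \<xi>)"
  shows "uniform_limit T (\<lambda>\<kappa> t. \<Prod>z\<in>B. \<bar>gap_map \<xi> \<kappa> t - gap_map \<xi> \<kappa> z\<bar> / \<kappa>) (\<lambda>_. 1) at_top"
proof -
  have "uniform_limit T (\<lambda>\<kappa> t. \<Prod>z\<in>B. \<bar>gap_map \<xi> \<kappa> t - gap_map \<xi> \<kappa> z\<bar> / \<kappa>)
      (\<lambda>_. \<Prod>z\<in>B. 1) at_top"
    using assms by (intro uniform_limit_prod_bounded[THEN conjunct1] uniform_limit_gap_over_width)
      (auto simp: image_constant_conv)
  then show ?thesis by simp
qed

lemma tendsto_prod_gap_over_width: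
  assumes "finite B" "\<And>z. z \<in> B \<Longrightarrow> (y \<le> \<xi>) \<noteq> (z \<le> \<xi>)"
  shows "((\<lambda>\<kappa>. \<Prod>z\<in>B. \<bar>gap_map \<xi> \<kappa> y - gap_map \<xi> \<kappa> z\<bar> / \<kappa>) \<longlongrightarrow> 1) at_top"
  using uniform_limit_prod_gap_over_width[of "{y}" B \<xi>] assms by simp

lemma gap_map_diff_same_side:
  "(u \<le> \<xi>) = (v \<le> \<xi>) \<Longrightarrow> gap_map \<xi> \<kappa> u - gap_map \<xi> \<kappa> v = u - v"
  by (simp add: gap_map_def)

section \<open>Limits of the mapped basis functions\<close>

text \<open>The modulus of a mapped basis function, indexed by the node \<open>y\<close> itself instead of its position,
  so that the nodes can be partitioned according to their side of \<open>\<xi>\<close>.\<close>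

definition abs_mapped_basis :: "real \<Rightarrow> real \<Rightarrow> real set \<Rightarrow> real \<Rightarrow> real \<Rightarrow> real" where
  "abs_mapped_basis \<xi> \<kappa> Y y t =
     (\<Prod>z\<in>Y - {y}. \<bar>(gap_map \<xi> \<kappa> t - gap_map \<xi> \<kappa> z) / (gap_map \<xi> \<kappa> y - gap_map \<xi> \<kappa> z)\<bar>)"

lemma abs_mapped_lagrange:
  assumes "inj_on x {0..n}" "i \<le> n"
  shows "\<bar>mapped_lagrange (gap_map \<xi> \<kappa>) n x i t\<bar> = abs_mapped_basis \<xi> \<kappa> (x ` {0..n}) (x i) t"
proof -
  have "x ` {0..n} - {x i} = x ` ({0..n} - {i})" "inj_on x ({0..n} - {i})"
    using assms by (auto simp: inj_on_def)
  then show ?thesis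
    by (simp add: mapped_lagrange_def abs_mapped_basis_def prod.reindex abs_prod)
qed

lemma bounded_continuous_image:
  fixes h :: "real \<Rightarrow> real"
  assumes "continuous_on UNIV h" "bounded T"
  shows "bounded (h ` T)"
proof -
  have "compact (h ` closure T)"
    using assms by (intro compact_continuous_image continuous_on_subset[OF assms(1)])
      (auto simp: compact_closure)
  then show ?thesis
    by (meson bounded_subset closure_subset compact_imp_bounded image_mono)
qed

text \<open>In this section \<open>s\<close> tells the side of \<open>T\<close>: true for left of \<open>\<xi>\<close>, false for right of
  it. The two sides behave symmetrically and are thus treated at once.

  For \<open>y\<close> on the side of \<open>t\<close>, the factors over \<open>A\<close> do not see the gap, and each factor over \<open>B\<close> is a
  quotient of two crossing differences and tends to \<open>1\<close>.\<close>

lemma same_side_basis_limit: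
  fixes T A B :: "real set"
  assumes "bounded T" "finite A" "finite B"
    and T: "\<And>t. t \<in> T \<Longrightarrow> (t \<le> \<xi>) = s"
    and A: "\<And>z. z \<in> A \<Longrightarrow> (z \<le> \<xi>) = s"
    and B: "\<And>z. z \<in> B \<Longrightarrow> (z \<le> \<xi>) \<noteq> s"
    and y: "y \<in> A"
  shows "uniform_limit T (\<lambda>\<kappa>. abs_mapped_basis \<xi> \<kappa> (A \<union> B) y)
           (\<lambda>t. \<Prod>z\<in>A - {y}. \<bar>(t - z) / (y - z)\<bar>) at_top"
proof -
  define P where "P \<kappa> t = (\<Prod>z\<in>B. \<bar>gap_map \<xi> \<kappa> t - gap_map \<xi> \<kappa> z\<bar> / \<kappa>)" for \<kappa> t
  define L where "L t = (\<Prod>z\<in>A - {y}. \<bar>(t - z) / (y - z)\<bar>)" for t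
  have P: "uniform_limit T P (\<lambda>_. 1) at_top"
    unfolding P_def using assms by (intro uniform_limit_prod_gap_over_width) auto
  have Py: "((\<lambda>\<kappa>. P \<kappa> y) \<longlongrightarrow> 1) at_top"
    unfolding P_def using assms by (intro tendsto_prod_gap_over_width) auto
  then have "uniform_limit T (\<lambda>\<kappa> t. P \<kappa> y) (\<lambda>_. 1) at_top"
    unfolding tendsto_iff uniform_limit_iff by (auto elim: eventually_mono)
  then have "uniform_limit T (\<lambda>\<kappa> t. P \<kappa> t / P \<kappa> y) (\<lambda>_. 1 / 1) at_top"
    using P by (intro uniform_lim_divide[where b = 1]) (auto simp: image_constant_conv)
  moreover have "bounded (L ` T)"
    unfolding L_def using \<open>bounded T\<close> A y
    by (intro bounded_continuous_image) (auto intro!: continuous_intros)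
  ultimately have lim: "uniform_limit T (\<lambda>\<kappa> t. L t * (P \<kappa> t / P \<kappa> y)) (\<lambda>t. L t * (1 / 1)) at_top"
    by (intro uniform_lim_mult uniform_limit_const) (auto simp: image_constant_conv)
  have "\<forall>\<^sub>F \<kappa> in at_top. \<forall>t\<in>T. L t * (P \<kappa> t / P \<kappa> y) = abs_mapped_basis \<xi> \<kappa> (A \<union> B) y t"
    using eventually_gt_at_top[of 0]
  proof eventually_elim
    case (elim \<kappa>)
    show ?case
    proof
      fix t assume t: "t \<in> T"
      have "A \<union> B - {y} = (A - {y}) \<union> B" "(A - {y}) \<inter> B = {}" using A B y by auto
      then have "abs_mapped_basis \<xi> \<kappa> (A \<union> B) y t =
        (\<Prod>z\<in>A - {y}. \<bar>(gap_map \<xi> \<kappa> t - gap_map \<xi> \<kappa> z) / (gap_map \<xi> \<kappa> y - gap_map \<xi> \<kappa> z)\<bar>)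
        * (\<Prod>z\<in>B. \<bar>(gap_map \<xi> \<kappa> t - gap_map \<xi> \<kappa> z) / (gap_map \<xi> \<kappa> y - gap_map \<xi> \<kappa> z)\<bar>)"
        unfolding abs_mapped_basis_def using assms by (simp add: prod.union_disjoint)
      also have "(\<Prod>z\<in>A - {y}. \<bar>(gap_map \<xi> \<kappa> t - gap_map \<xi> \<kappa> z) / (gap_map \<xi> \<kappa> y - gap_map \<xi> \<kappa> z)\<bar>) = L t"
        unfolding L_def using T[OF t] A y
        by (intro prod.cong refl) (auto simp: gap_map_diff_same_side)
      also have "(\<Prod>z\<in>B. \<bar>(gap_map \<xi> \<kappa> t - gap_map \<xi> \<kappa> z) / (gap_map \<xi> \<kappa> y - gap_map \<xi> \<kappa> z)\<bar>) = P \<kappa> t / P \<kappa> y"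
        unfolding P_def prod_dividef[symmetric] using elim by (intro prod.cong refl) simp
      finally show "L t * (P \<kappa> t / P \<kappa> y) = abs_mapped_basis \<xi> \<kappa> (A \<union> B) y t" by simp
    qed
  qed
  then show ?thesis
    unfolding L_def[symmetric]
    using lim by (subst uniform_limit_cong[where g = "\<lambda>\<kappa> t. L t * (P \<kappa> t / P \<kappa> y)" and i = L])
      (auto elim: eventually_mono)
qed

lemma power_ratio_tendsto:
  assumes "m \<le> k"
  shows "((\<lambda>\<kappa>::real. \<kappa> ^ m / \<kappa> ^ k) \<longlongrightarrow> (if m = k then 1 else 0)) at_top"
proof (cases "m = k")
  case True
  then show ?thesis
    by (auto intro!: tendsto_eventually eventually_mono[OF eventually_gt_at_top[of 0]])
next
  case False
  have "((\<lambda>\<kappa>::real. inverse (\<kappa> ^ (k - m))) \<longlongrightarrow> 0) at_top"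
    using False assms by (intro tendsto_inverse_0_at_top filterlim_pow_at_top filterlim_ident) auto
  moreover have "\<forall>\<^sub>F \<kappa>::real in at_top. inverse (\<kappa> ^ (k - m)) = \<kappa> ^ m / \<kappa> ^ k"
    using eventually_gt_at_top[of 0]
    by eventually_elim (use assms in \<open>simp add: power_diff field_simps\<close>)
  ultimately show ?thesis using False by (simp add: Lim_transform_eventually)
qed

text \<open>For \<open>y\<close> across the gap from \<open>t\<close>, a node of \<open>A\<close> contributes a crossing difference to the
  denominator only, and a node of \<open>B - {y}\<close> to the numerator only. After normalising all of them by
  \<open>\<kappa>\<close>, what remains is the product of \<open>\<bar>t - z\<bar>\<close> and \<open>\<bar>1 / (y - z)\<bar>\<close>, which is constant in \<open>\<kappa>\<close>, times
  \<open>\<kappa> ^ (\<bar>B\<bar> - 1) / \<kappa> ^ \<bar>A\<bar>\<close>.\<close>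

lemma opposite_side_basis_limit:
  fixes T A B :: "real set"
  assumes "bounded T" "finite A" "finite B"
    and T: "\<And>t. t \<in> T \<Longrightarrow> (t \<le> \<xi>) = s"
    and A: "\<And>z. z \<in> A \<Longrightarrow> (z \<le> \<xi>) = s"
    and B: "\<And>z. z \<in> B \<Longrightarrow> (z \<le> \<xi>) \<noteq> s"
    and y: "y \<in> B" and card: "card B \<le> card A + 1"
  shows "uniform_limit T (\<lambda>\<kappa>. abs_mapped_basis \<xi> \<kappa> (A \<union> B) y)
           (\<lambda>t. of_bool (card B = card A + 1) * ((\<Prod>z\<in>A. \<bar>t - z\<bar>) * (\<Prod>z\<in>B - {y}. \<bar>1 / (y - z)\<bar>)))
           at_top"
proof -
  define P where "P \<kappa> t = (\<Prod>z\<in>B - {y}. \<bar>gap_map \<xi> \<kappa> t - gap_map \<xi> \<kappa> z\<bar> / \<kappa>)" for \<kappa> t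
  define Q where "Q \<kappa> = (\<Prod>z\<in>A. \<bar>gap_map \<xi> \<kappa> y - gap_map \<xi> \<kappa> z\<bar> / \<kappa>)" for \<kappa>
  define w where "w \<kappa> = \<kappa> ^ card (B - {y}) / \<kappa> ^ card A" for \<kappa> :: real
  define c :: real where "c = of_bool (card B = card A + 1)"
  define L where "L t = (\<Prod>z\<in>A. \<bar>t - z\<bar>) * (\<Prod>z\<in>B - {y}. \<bar>1 / (y - z)\<bar>)" for t
  have P: "uniform_limit T P (\<lambda>_. 1) at_top"
    unfolding P_def using assms by (intro uniform_limit_prod_gap_over_width) auto
  have Q: "(Q \<longlongrightarrow> 1) at_top"
    unfolding Q_def using assms by (intro tendsto_prod_gap_over_width) auto
  have "card B = card (B - {y}) + 1"
    using card_Suc_Diff1[OF \<open>finite B\<close> y] by simp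
  then have w: "(w \<longlongrightarrow> c) at_top"
    using power_ratio_tendsto[of "card (B - {y})" "card A"] card
    unfolding w_def c_def by (simp add: of_bool_def)
  have "((\<lambda>\<kappa>. w \<kappa> / Q \<kappa>) \<longlongrightarrow> c / 1) at_top" using w Q by (intro tendsto_divide) auto
  then have "uniform_limit T (\<lambda>\<kappa> t. w \<kappa> / Q \<kappa>) (\<lambda>_. c) at_top"
    unfolding tendsto_iff uniform_limit_iff by (auto elim: eventually_mono)
  then have wQP: "uniform_limit T (\<lambda>\<kappa> t. w \<kappa> / Q \<kappa> * P \<kappa> t) (\<lambda>_. c * 1) at_top"
    using P by (intro uniform_lim_mult) (auto simp: image_constant_conv)
  have "bounded (L ` T)"
    unfolding L_def using \<open>bounded T\<close>
    by (intro bounded_continuous_image) (auto intro!: continuous_intros)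
  then have lim: "uniform_limit T (\<lambda>\<kappa> t. w \<kappa> / Q \<kappa> * P \<kappa> t * L t) (\<lambda>t. c * 1 * L t) at_top"
    by (intro uniform_lim_mult[OF wQP uniform_limit_const]) (auto simp: image_constant_conv)
  have "\<forall>\<^sub>F \<kappa> in at_top. \<forall>t\<in>T. w \<kappa> / Q \<kappa> * P \<kappa> t * L t = abs_mapped_basis \<xi> \<kappa> (A \<union> B) y t"
    using eventually_gt_at_top[of 0]
  proof eventually_elim
    case (elim \<kappa>)
    show ?case
    proof
      fix t assume t: "t \<in> T"
      have "A \<union> B - {y} = A \<union> (B - {y})" "A \<inter> (B - {y}) = {}" using A B y by auto
      then have "abs_mapped_basis \<xi> \<kappa> (A \<union> B) y t =
        (\<Prod>z\<in>A. \<bar>(gap_map \<xi> \<kappa> t - gap_map \<xi> \<kappa> z) / (gap_map \<xi> \<kappa> y - gap_map \<xi> \<kappa> z)\<bar>)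
        * (\<Prod>z\<in>B - {y}. \<bar>(gap_map \<xi> \<kappa> t - gap_map \<xi> \<kappa> z) / (gap_map \<xi> \<kappa> y - gap_map \<xi> \<kappa> z)\<bar>)"
        unfolding abs_mapped_basis_def using assms by (simp add: prod.union_disjoint)
      also have "(\<Prod>z\<in>A. \<bar>(gap_map \<xi> \<kappa> t - gap_map \<xi> \<kappa> z) / (gap_map \<xi> \<kappa> y - gap_map \<xi> \<kappa> z)\<bar>)
          = (\<Prod>z\<in>A. \<bar>t - z\<bar> / (\<bar>gap_map \<xi> \<kappa> y - gap_map \<xi> \<kappa> z\<bar> / \<kappa> * \<kappa>))"
        using T[OF t] A elim by (intro prod.cong refl) (auto simp: gap_map_diff_same_side)
      also have "\<dots> = (\<Prod>z\<in>A. \<bar>t - z\<bar>) / (Q \<kappa> * \<kappa> ^ card A)"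
        unfolding Q_def by (simp only: prod_dividef prod.distrib prod_constant)
      also have "(\<Prod>z\<in>B - {y}. \<bar>(gap_map \<xi> \<kappa> t - gap_map \<xi> \<kappa> z) / (gap_map \<xi> \<kappa> y - gap_map \<xi> \<kappa> z)\<bar>)
          = (\<Prod>z\<in>B - {y}. \<bar>gap_map \<xi> \<kappa> t - gap_map \<xi> \<kappa> z\<bar> / \<kappa> * \<kappa> * \<bar>1 / (y - z)\<bar>)"
        using B y elim by (intro prod.cong refl) (auto simp: gap_map_diff_same_side)
      also have "\<dots> = P \<kappa> t * \<kappa> ^ card (B - {y}) * (\<Prod>z\<in>B - {y}. \<bar>1 / (y - z)\<bar>)"
        unfolding P_def by (simp only: prod.distrib prod_constant)
      finally show "w \<kappa> / Q \<kappa> * P \<kappa> t * L t = abs_mapped_basis \<xi> \<kappa> (A \<union> B) y t"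
        unfolding w_def L_def by (simp add: field_simps)
    qed
  qed
  then have "uniform_limit T (\<lambda>\<kappa>. abs_mapped_basis \<xi> \<kappa> (A \<union> B) y) (\<lambda>t. c * L t) at_top"
    using lim by (subst uniform_limit_cong[where g = "\<lambda>\<kappa> t. w \<kappa> / Q \<kappa> * P \<kappa> t * L t" and i = "\<lambda>t. c * L t"])
      (auto elim: eventually_mono)
  then show ?thesis unfolding L_def c_def .
qed

lemma one_sided_sum_limit:
  fixes T A B :: "real set"
  assumes "bounded T" "finite A" "finite B"
    and "\<And>t. t \<in> T \<Longrightarrow> (t \<le> \<xi>) = s"
    and A: "\<And>z. z \<in> A \<Longrightarrow> (z \<le> \<xi>) = s"
    and B: "\<And>z. z \<in> B \<Longrightarrow> (z \<le> \<xi>) \<noteq> s"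
    and "card B \<le> card A + 1"
  shows "uniform_limit T (\<lambda>\<kappa> t. \<Sum>y\<in>A \<union> B. abs_mapped_basis \<xi> \<kappa> (A \<union> B) y t)
           (\<lambda>t. of_bool (card B = card A + 1) *
                  (\<Sum>y\<in>B. (\<Prod>z\<in>A. \<bar>t - z\<bar>) * (\<Prod>z\<in>B - {y}. \<bar>1 / (y - z)\<bar>))
                + lebesgue_function A t) at_top"
    (is "uniform_limit T ?f ?g at_top")
proof -
  have "A \<inter> B = {}" using A B by auto
  then have f: "?f = (\<lambda>\<kappa> t. (\<Sum>y\<in>B. abs_mapped_basis \<xi> \<kappa> (A \<union> B) y t)
      + (\<Sum>y\<in>A. abs_mapped_basis \<xi> \<kappa> (A \<union> B) y t))"
    using assms by (simp add: sum.union_disjoint add.commute)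
  show ?thesis
    unfolding f lebesgue_function_def sum_distrib_left using assms
    by (intro uniform_limit_add uniform_limit_sum same_side_basis_limit[where s = s]
        opposite_side_basis_limit[where s = s]) auto
qed

section \<open>Limit of the mapped Lebesgue constant\<close>

lemma bounded_lebesgue_function_image:
  "bounded T \<Longrightarrow> bounded (lebesgue_function Y ` T)"
  unfolding lebesgue_function_def
  by (intro bounded_continuous_image) (auto intro!: continuous_intros)

text \<open>The residuals are written with node positions; for sorted nodes, these positions can be read off
  from the number of nodes left of \<open>\<xi>\<close>.\<close>

lemma sorted_image_split:
  fixes x :: "nat \<Rightarrow> real"
  assumes x: "strict_mono_on {0..n} x"
    and card: "card {y \<in> x ` {0..n}. y \<le> \<xi>} = p"
  shows "{y \<in> x ` {0..n}. y \<le> \<xi>} = x ` {0..<p}" "{y \<in> x ` {0..n}. y > \<xi>} = x ` {p..n}"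
proof -
  define I where "I = {i \<in> {0..n}. x i \<le> \<xi>}"
  have inj: "inj_on x {0..n}" by (rule strict_mono_on_imp_inj_on[OF x])
  have I: "{y \<in> x ` {0..n}. y \<le> \<xi>} = x ` I" unfolding I_def by auto
  have "inj_on x I" using inj by (rule inj_on_subset) (auto simp: I_def)
  then have cI: "card I = p" using card by (simp add: I card_image)
  have down: "j \<in> I" if "i \<in> I" "j \<le> i" for i j
    using that strict_mono_onD[OF x, of j i] unfolding I_def
    by (cases "j = i") auto
  have fin: "finite I" unfolding I_def by auto
  have "I = {0..<p}"
  proof (rule card_subset_eq)
    show "I \<subseteq> {0..<p}"
    proof
      fix i assume "i \<in> I"
      then have "{0..i} \<subseteq> I" using down by auto
      then have "card {0..i} \<le> card I" using fin by (rule card_mono[rotated])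
      then show "i \<in> {0..<p}" using cI by simp
    qed
  qed (use cI in auto)
  then show "{y \<in> x ` {0..n}. y \<le> \<xi>} = x ` {0..<p}" using I by simp
  have "{y \<in> x ` {0..n}. y > \<xi>} = x ` ({0..n} - I)" unfolding I_def by auto
  also have "{0..n} - I = {p..n}" using \<open>I = {0..<p}\<close> by auto
  finally show "{y \<in> x ` {0..n}. y > \<xi>} = x ` {p..n}" .
qed

lemma sum_abs_gap_residual:
  fixes x :: "nat \<Rightarrow> real"
  assumes inj: "inj_on x {0..n}"
  shows "(\<Sum>i=0..n div 2. \<bar>gap_residual n x i t\<bar>) =
    (\<Sum>y\<in>x ` {0..n div 2}. (\<Prod>z\<in>x ` {n div 2 + 1..n}. \<bar>t - z\<bar>)
        * (\<Prod>z\<in>x ` {0..n div 2} - {y}. \<bar>1 / (y - z)\<bar>))"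
proof -
  have inj1: "inj_on x {0..n div 2}" and inj2: "inj_on x {n div 2 + 1..n}"
    by (rule inj_on_subset[OF inj]; auto)+
  have *: "x ` {0..n div 2} - {x i} = x ` ({0..n div 2} - {i})" "inj_on x ({0..n div 2} - {i})"
    if "i \<le> n div 2" for i
    using inj1 that by (auto simp: inj_on_def)
  show ?thesis
    unfolding sum.reindex[OF inj1] prod.reindex[OF inj2]
    by (intro sum.cong refl) (simp add: gap_residual_def abs_mult abs_prod * prod.reindex)
qed

theorem theorem1:
  fixes a b \<xi> :: real and n :: nat and x :: "nat \<Rightarrow> real"
    and \<Omega> \<Omega>1 \<Omega>2 X1 X2 :: "real set"
  assumes \<Omega>: "\<Omega> = {a..b}"
    and nodes_in: "\<And>i. i \<le> n \<Longrightarrow> x i \<in> \<Omega>"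
    and nodes_sorted: "strict_mono_on {0..n} x"
    and \<xi>_interior: "a < \<xi>" "\<xi> < b"
    and X1: "X1 = {y \<in> x ` {0..n}. y \<le> \<xi>}"
    and X2: "X2 = {y \<in> x ` {0..n}. y > \<xi>}"
    and cards: "card X1 = card X2 \<or> card X1 = card X2 + 1"
    and \<Omega>1: "\<Omega>1 = {a..\<xi>}"
    and \<Omega>2: "\<Omega>2 = {\<xi><..b}"
  shows "((\<lambda>\<kappa>. mapped_lebesgue_constant (gap_map \<xi> \<kappa>) n x \<Omega>) \<longlongrightarrow>
           (if card X1 = card X2
            then max (lebesgue_constant X1 \<Omega>1) (lebesgue_constant X2 \<Omega>2)
            else max (lebesgue_constant X1 \<Omega>1) (gap_residual_constant n x X2 \<Omega>2))) at_top"
proof -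
  have inj: "inj_on x {0..n}" by (rule strict_mono_on_imp_inj_on[OF nodes_sorted])
  have fin: "finite X1" "finite X2" unfolding X1 X2 by auto
  have X: "x ` {0..n} = X1 \<union> X2" unfolding X1 X2 by auto
  have \<Omega>_split: "\<Omega> = \<Omega>1 \<union> \<Omega>2" using \<xi>_interior unfolding \<Omega> \<Omega>1 \<Omega>2 by auto
  have ne: "\<Omega>1 \<noteq> {}" "\<Omega>2 \<noteq> {}" using \<xi>_interior unfolding \<Omega>1 \<Omega>2 by auto
  have "bounded \<Omega>" unfolding \<Omega> by (intro compact_imp_bounded compact_Icc)
  then have bdd: "bounded \<Omega>1" "bounded \<Omega>2" unfolding \<Omega>_split by auto
  define f where "f \<kappa> t = (\<Sum>y\<in>X1 \<union> X2. abs_mapped_basis \<xi> \<kappa> (X1 \<union> X2) y t)" for \<kappa> t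
  define r where "r t = of_bool (card X1 = card X2 + 1) *
      (\<Sum>y\<in>X1. (\<Prod>z\<in>X2. \<bar>t - z\<bar>) * (\<Prod>z\<in>X1 - {y}. \<bar>1 / (y - z)\<bar>))" for t
  \<comment> \<open>The pointwise limit of \<open>f \<kappa>\<close>, with \<open>r\<close> the contribution of the left nodes to its values right
    of \<open>\<xi>\<close>.\<close>
  define g where "g t = (if t \<le> \<xi> then lebesgue_function X1 t else r t + lebesgue_function X2 t)" for t
  have f: "mapped_lebesgue_constant (gap_map \<xi> \<kappa>) n x \<Omega> = (SUP t\<in>\<Omega>. f \<kappa> t)" for \<kappa>
    unfolding mapped_lebesgue_constant_def f_def X[symmetric] sum.reindex[OF inj]
    by (simp add: abs_mapped_lagrange[OF inj])
  have g1: "g t = lebesgue_function X1 t" if "t \<in> \<Omega>1" for t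
    using that unfolding g_def \<Omega>1 by auto
  have g2: "g t = r t + lebesgue_function X2 t" if "t \<in> \<Omega>2" for t
    using that unfolding g_def \<Omega>2 by auto
  have "uniform_limit \<Omega>1 f (\<lambda>t. of_bool (card X2 = card X1 + 1) *
      (\<Sum>y\<in>X2. (\<Prod>z\<in>X1. \<bar>t - z\<bar>) * (\<Prod>z\<in>X2 - {y}. \<bar>1 / (y - z)\<bar>)) + lebesgue_function X1 t) at_top"
    unfolding f_def using bdd fin cards
    by (intro one_sided_sum_limit[where s = True]) (auto simp: \<Omega>1 X1 X2)
  \<comment> \<open>There are never more nodes on the right than on the left, so the right nodes contribute
    nothing on the left.\<close>
  then have lim1: "uniform_limit \<Omega>1 f g at_top"
    using cards by (auto simp: g1 cong: uniform_limit_cong')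
  have "uniform_limit \<Omega>2 f (\<lambda>t. r t + lebesgue_function X2 t) at_top"
    unfolding f_def r_def Un_commute[of X1 X2] using bdd fin cards
    by (intro one_sided_sum_limit[where s = False]) (auto simp: \<Omega>2 X1 X2)
  then have lim2: "uniform_limit \<Omega>2 f g at_top"
    by (simp add: g2 cong: uniform_limit_cong')
  have bg1: "bounded (g ` \<Omega>1)"
    using bounded_lebesgue_function_image[OF bdd(1)] by (simp add: g1 cong: image_cong)
  have "bounded ((\<lambda>t. r t + lebesgue_function X2 t) ` \<Omega>2)"
    unfolding r_def lebesgue_function_def using bdd(2)
    by (intro bounded_continuous_image) (auto intro!: continuous_intros)
  then have bg2: "bounded (g ` \<Omega>2)" by (simp add: g2 cong: image_cong)
  have "((\<lambda>\<kappa>. SUP t\<in>\<Omega>. f \<kappa> t) \<longlongrightarrow> (SUP t\<in>\<Omega>. g t)) at_top"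
    unfolding \<Omega>_split using lim1 lim2 bg1 bg2 ne
    by (intro tendsto_SUP_uniform_limit uniform_limit_on_Un) (auto simp: image_Un)
  moreover have "(SUP t\<in>\<Omega>. g t) = max (SUP t\<in>\<Omega>1. g t) (SUP t\<in>\<Omega>2. g t)"
    unfolding \<Omega>_split sup_max[symmetric] using bg1 bg2 ne
    by (intro cSUP_union) (auto intro: bounded_imp_bdd_above)
  moreover have "(SUP t\<in>\<Omega>1. g t) = lebesgue_constant X1 \<Omega>1"
    unfolding lebesgue_constant_def using g1 by (intro SUP_cong refl) auto
  moreover have "(SUP t\<in>\<Omega>2. g t) =
      (if card X1 = card X2 then lebesgue_constant X2 \<Omega>2 else gap_residual_constant n x X2 \<Omega>2)"
  proof (cases "card X1 = card X2")
    case True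
    then show ?thesis
      unfolding lebesgue_constant_def by (simp add: g2 r_def cong: SUP_cong)
  next
    case False
    have "card X1 + card X2 = card (x ` {0..n})"
      unfolding X using fin by (intro card_Un_disjoint[symmetric]) (auto simp: X1 X2)
    also have "\<dots> = n + 1" using inj by (simp add: card_image)
    finally have "card X1 = n div 2 + 1" using False cards by presburger
    then have "X1 = x ` {0..<n div 2 + 1}" "X2 = x ` {n div 2 + 1..n}"
      using sorted_image_split[OF nodes_sorted] unfolding X1 X2 by blast+
    then have "X1 = x ` {0..n div 2}" "X2 = x ` {n div 2 + 1..n}"
      by (simp_all add: atLeastLessThanSuc_atLeastAtMost)
    then have "r t = (\<Sum>i=0..n div 2. \<bar>gap_residual n x i t\<bar>)" for t
      unfolding sum_abs_gap_residual[OF inj] r_def using False cards by auto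
    then show ?thesis
      unfolding gap_residual_constant_def using False g2 by (simp cong: SUP_cong)
  qed
  ultimately show ?thesis unfolding f by (cases "card X1 = card X2") simp_all
qed

end
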